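(* Let $(\mathbb{R}^n,g)$ be a pseudo-Euclidean space, $n\ge 3$, with coordinates $x=(x_1,\dots,x_n)$ and $g_{ij}=\delta_{ij}\varepsilon_i$, $\varepsilon_i\in\{-1,1\}$. Consider warped products $M=(\mathbb{R}^n,\bar g)\times_f F^m$ with metric $\tilde g=\bar g\oplus f^2g_F$, where $\bar g=\frac{1}{\varphi^2}g$, $F$ is a semi-Riemannian manifold of dimension $m\ge 1$ with constant scalar curvature $\lambda_F$, and $f,\varphi,h:\mathbb{R}^n\to\mathbb{R}$ are smooth functions with $f>0$ which are functions $f(\xi),\varphi(\xi),h(\xi)$ of $\xi=\sum_{k=1}^n\alpha_kx_k$, $\alpha_k\in\mathbb{R}$. Assume that $X=\sum_k\alpha_k\frac{\partial}{\partial x_k}$ is a lightlike vector (i.e. $X\neq0$ and $\sum_k\varepsilon_k\alpha_k^2=0$). If $\lambda_F>0$, then there is no expanding or steady gradient Yamabe soliton with warped metric $\tilde g$ and potential function $h$. Similarly, if $\lambda_F<0$, then there is no shrinking or steady gradient Yamabe soliton with warped metric $\tilde g$ and potential function $h$.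
   Context: A pseudo-Riemannian manifold $(M,g)$ is a gradient Yamabe soliton with potential function $h$ if there is a real constant $\rho$ with $(S_g-\rho)g=\mathrm{Hess}_g(h)$, where $S_g$ is the scalar curvature; it is shrinking, steady or expanding if $\rho>0$, $\rho=0$, $\rho<0$, respectively. The warped product $B\times_f F$ is $B\times F$ with metric $\tilde g=g_B\oplus f^2g_F$. The function $h$ on $\mathbb{R}^n$ is regarded as a function on $M=\mathbb{R}^n\times F$ by composing with the projection to $\mathbb{R}^n$. Since $\bar g=\frac1{\varphi^2}g$ must be a metric, $\varphi$ is nowhere zero. *)

theory Defs
  imports "HOL-Analysis.Analysis"
begin

section \<open>Smooth functions on open subsets of coordinate space\<close>

definition partial :: "'k::finite \<Rightarrow> (real^'k \<Rightarrow> real) \<Rightarrow> real^'k \<Rightarrow> real" where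
  "partial a u y = deriv (\<lambda>t. u (y + t *\<^sub>R axis a 1)) 0"

primrec Ck_on :: "nat \<Rightarrow> (real^'k::finite) set \<Rightarrow> (real^'k \<Rightarrow> real) \<Rightarrow> bool" where
  "Ck_on 0 S u \<longleftrightarrow> continuous_on S u"
| "Ck_on (Suc r) S u \<longleftrightarrow> (\<forall>y\<in>S. u differentiable (at y)) \<and> (\<forall>a. Ck_on r S (partial a u))"

text \<open>Only used for open \<open>S\<close>.\<close>

definition smooth_on :: "(real^'k::finite) set \<Rightarrow> (real^'k \<Rightarrow> real) \<Rightarrow> bool" where
  "smooth_on S u \<longleftrightarrow> (\<forall>r. Ck_on r S u)"


section \<open>Smooth manifolds and metrics\<close>

text \<open>
  A manifold is a topology together with an atlas, given as a family of charts indexed by the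
  set \<open>charts\<close>. The coordinate map of chart \<open>i\<close> matters on \<open>chart_dom M i\<close> only.
\<close>

record ('a, 'i, 'k) manifold =
  mtop :: "'a topology"
  charts :: "'i set"
  chart_dom :: "'i \<Rightarrow> 'a set"
  chart_map :: "'i \<Rightarrow> 'a \<Rightarrow> real^'k"

definition chart_image :: "('a, 'i, 'k::finite) manifold \<Rightarrow> 'i \<Rightarrow> (real^'k) set" where
  "chart_image M i = chart_map M i ` chart_dom M i"

definition chart_inv :: "('a, 'i, 'k::finite) manifold \<Rightarrow> 'i \<Rightarrow> real^'k \<Rightarrow> 'a" where
  "chart_inv M i = inv_into (chart_dom M i) (chart_map M i)"

definition transition ::
    "('a, 'i, 'k::finite) manifold \<Rightarrow> 'i \<Rightarrow> 'i \<Rightarrow> 'k \<Rightarrow> real^'k \<Rightarrow> real" where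
  "transition M i j b y = chart_map M j (chart_inv M i y) $ b"

definition smooth_manifold :: "('a, 'i, 'k::finite) manifold \<Rightarrow> bool" where
  "smooth_manifold M \<longleftrightarrow>
     topspace (mtop M) \<noteq> {} \<and> Hausdorff_space (mtop M) \<and> second_countable (mtop M) \<and>
     (\<Union>i\<in>charts M. chart_dom M i) = topspace (mtop M) \<and>
     (\<forall>i\<in>charts M. openin (mtop M) (chart_dom M i) \<and> open (chart_image M i) \<and>
        homeomorphic_map (subtopology (mtop M) (chart_dom M i)) (top_of_set (chart_image M i))
          (chart_map M i)) \<and>
     (\<forall>i\<in>charts M. \<forall>j\<in>charts M. \<forall>b.
        smooth_on (chart_map M i ` (chart_dom M i \<inter> chart_dom M j)) (transition M i j b))"

text \<open>
  A tensor field of type (0,2) is given by its matrix of components in every chart: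
  \<open>g i p $ a $ b\<close> is the value at \<open>p\<close> on the coordinate vectors \<open>a\<close> and \<open>b\<close> of chart \<open>i\<close>.
\<close>

type_synonym ('a, 'i, 'k) tensor2 = "'i \<Rightarrow> 'a \<Rightarrow> real^'k^'k"

definition local_comp ::
    "('a, 'i, 'k::finite) manifold \<Rightarrow> ('a, 'i, 'k) tensor2 \<Rightarrow> 'i \<Rightarrow> real^'k \<Rightarrow> real^'k^'k" where
  "local_comp M g i y = g i (chart_inv M i y)"

definition transition_jacobian ::
    "('a, 'i, 'k::finite) manifold \<Rightarrow> 'i \<Rightarrow> 'i \<Rightarrow> 'a \<Rightarrow> real^'k^'k" where
  "transition_jacobian M i j p = (\<chi> b a. partial a (transition M i j b) (chart_map M i p))"

definition pseudo_riemannian ::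
    "('a, 'i, 'k::finite) manifold \<Rightarrow> ('a, 'i, 'k) tensor2 \<Rightarrow> bool" where
  "pseudo_riemannian M g \<longleftrightarrow>
     smooth_manifold M \<and>
     (\<forall>i\<in>charts M. \<forall>a b. smooth_on (chart_image M i) (\<lambda>y. local_comp M g i y $ a $ b)) \<and>
     (\<forall>i\<in>charts M. \<forall>p\<in>chart_dom M i. transpose (g i p) = g i p \<and> invertible (g i p)) \<and>
     (\<forall>i\<in>charts M. \<forall>j\<in>charts M. \<forall>p\<in>chart_dom M i \<inter> chart_dom M j.
        g i p = transpose (transition_jacobian M i j p) ** g j p **
          transition_jacobian M i j p)"


section \<open>Curvature and Hessian\<close>

text \<open>
  The next four functions take the matrix \<open>G\<close> of metric components as a function of the local
  coordinates. The coefficient \<open>riemann G d c a b\<close> is the \<open>d\<close>-component of \<open>R(a, b) c\<close> with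
  \<open>R(X, Y) = \<nabla>\<^sub>X \<nabla>\<^sub>Y - \<nabla>\<^sub>Y \<nabla>\<^sub>X - \<nabla>\<^bsub>[X,Y]\<^esub>\<close>; with this convention and the contraction below,
  round spheres have positive scalar curvature.
\<close>

definition christoffel ::
    "(real^'k \<Rightarrow> real^'k^'k) \<Rightarrow> 'k::finite \<Rightarrow> 'k \<Rightarrow> 'k \<Rightarrow> real^'k \<Rightarrow> real" where
  "christoffel G c a b y =
     (\<Sum>d\<in>UNIV. matrix_inv (G y) $ c $ d *
        (partial a (\<lambda>z. G z $ b $ d) y + partial b (\<lambda>z. G z $ a $ d) y
          - partial d (\<lambda>z. G z $ a $ b) y)) / 2"

definition riemann ::
    "(real^'k \<Rightarrow> real^'k^'k) \<Rightarrow> 'k::finite \<Rightarrow> 'k \<Rightarrow> 'k \<Rightarrow> 'k \<Rightarrow> real^'k \<Rightarrow> real" where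
  "riemann G d c a b y =
     partial a (christoffel G d b c) y - partial b (christoffel G d a c) y
     + (\<Sum>e\<in>UNIV. christoffel G d a e y * christoffel G e b c y
                  - christoffel G d b e y * christoffel G e a c y)"

definition ricci ::
    "(real^'k \<Rightarrow> real^'k^'k) \<Rightarrow> 'k::finite \<Rightarrow> 'k \<Rightarrow> real^'k \<Rightarrow> real" where
  "ricci G c b y = (\<Sum>a\<in>UNIV. riemann G a c a b y)"

definition scalar_coord ::
    "(real^'k::finite \<Rightarrow> real^'k^'k) \<Rightarrow> real^'k \<Rightarrow> real" where
  "scalar_coord G y = (\<Sum>c\<in>UNIV. \<Sum>b\<in>UNIV. matrix_inv (G y) $ c $ b * ricci G c b y)"

text \<open>
  The scalar curvature at \<open>p\<close> and the components of the Hessian at \<open>p\<close>, computed in the chart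
  \<open>i\<close>. Statements about them are made for all charts around \<open>p\<close>.
\<close>

definition scalar_curvature ::
    "('a, 'i, 'k::finite) manifold \<Rightarrow> ('a, 'i, 'k) tensor2 \<Rightarrow> 'i \<Rightarrow> 'a \<Rightarrow> real" where
  "scalar_curvature M g i p = scalar_coord (local_comp M g i) (chart_map M i p)"

definition hessian ::
    "('a, 'i, 'k::finite) manifold \<Rightarrow> ('a, 'i, 'k) tensor2 \<Rightarrow> ('a \<Rightarrow> real) \<Rightarrow>
     ('a, 'i, 'k) tensor2" where
  "hessian M g h i p = (\<chi> a b.
     let u = (\<lambda>y. h (chart_inv M i y)); y = chart_map M i p in
       partial a (partial b u) y
       - (\<Sum>c\<in>UNIV. christoffel (local_comp M g i) c a b y * partial c u y))"

definition constant_scalar_curvature ::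
    "('a, 'i, 'k::finite) manifold \<Rightarrow> ('a, 'i, 'k) tensor2 \<Rightarrow> real \<Rightarrow> bool" where
  "constant_scalar_curvature M g s \<longleftrightarrow>
     (\<forall>i\<in>charts M. \<forall>p\<in>chart_dom M i. scalar_curvature M g i p = s)"


section \<open>Gradient Yamabe solitons\<close>

text \<open>
  The conditions that \<open>g\<close> be a metric and that \<open>h\<close> be smooth are not repeated in the soliton
  predicate. Nonexistence statements formulated with it are thus not true merely because such a
  side condition fails.
\<close>

definition gradient_yamabe_soliton ::
    "('a, 'i, 'k::finite) manifold \<Rightarrow> ('a, 'i, 'k) tensor2 \<Rightarrow> ('a \<Rightarrow> real) \<Rightarrow> real \<Rightarrow> bool" where
  "gradient_yamabe_soliton M g h \<rho> \<longleftrightarrow>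
     (\<forall>i\<in>charts M. \<forall>p\<in>chart_dom M i.
        (scalar_curvature M g i p - \<rho>) *\<^sub>R g i p = hessian M g h i p)"

definition shrinking_soliton ::
    "('a, 'i, 'k::finite) manifold \<Rightarrow> ('a, 'i, 'k) tensor2 \<Rightarrow> ('a \<Rightarrow> real) \<Rightarrow> bool" where
  "shrinking_soliton M g h \<longleftrightarrow> (\<exists>\<rho>>0. gradient_yamabe_soliton M g h \<rho>)"

definition steady_soliton ::
    "('a, 'i, 'k::finite) manifold \<Rightarrow> ('a, 'i, 'k) tensor2 \<Rightarrow> ('a \<Rightarrow> real) \<Rightarrow> bool" where
  "steady_soliton M g h \<longleftrightarrow> gradient_yamabe_soliton M g h 0"

definition expanding_soliton ::
    "('a, 'i, 'k::finite) manifold \<Rightarrow> ('a, 'i, 'k) tensor2 \<Rightarrow> ('a \<Rightarrow> real) \<Rightarrow> bool" where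
  "expanding_soliton M g h \<longleftrightarrow> (\<exists>\<rho><0. gradient_yamabe_soliton M g h \<rho>)"


section \<open>Warped products\<close>

definition join_coords :: "real^'k \<Rightarrow> real^'l \<Rightarrow> real^('k::finite + 'l::finite)" where
  "join_coords v w = (\<chi> c. case c of Inl a \<Rightarrow> v $ a | Inr b \<Rightarrow> w $ b)"

definition product_manifold ::
    "('a, 'i, 'k::finite) manifold \<Rightarrow> ('b, 'j, 'l::finite) manifold \<Rightarrow>
     ('a \<times> 'b, 'i \<times> 'j, 'k + 'l) manifold" where
  "product_manifold B F =
     \<lparr> mtop = prod_topology (mtop B) (mtop F),
       charts = charts B \<times> charts F,
       chart_dom = (\<lambda>(i, j). chart_dom B i \<times> chart_dom F j),
       chart_map = (\<lambda>(i, j) (p, q). join_coords (chart_map B i p) (chart_map F j q)) \<rparr>"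

definition warped_metric ::
    "('a, 'i, 'k::finite) tensor2 \<Rightarrow> ('a \<Rightarrow> real) \<Rightarrow> ('b, 'j, 'l::finite) tensor2 \<Rightarrow>
     ('a \<times> 'b, 'i \<times> 'j, 'k + 'l) tensor2" where
  "warped_metric gB f gF = (\<lambda>(i, j) (p, q). \<chi> c d.
     (case (c, d) of
        (Inl a, Inl b) \<Rightarrow> gB i p $ a $ b
      | (Inr a, Inr b) \<Rightarrow> (f p)\<^sup>2 * gF j q $ a $ b
      | _ \<Rightarrow> 0))"


section \<open>Pseudo-Euclidean space\<close>

definition euclidean_manifold :: "(real^'n, unit, 'n::finite) manifold" where
  "euclidean_manifold =
     \<lparr> mtop = euclidean, charts = {()}, chart_dom = (\<lambda>_. UNIV), chart_map = (\<lambda>_ x. x) \<rparr>"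

definition pseudo_euclidean :: "('n \<Rightarrow> real) \<Rightarrow> (real^'n, unit, 'n::finite) tensor2" where
  "pseudo_euclidean \<epsilon> = (\<lambda>_ _. \<chi> i j. if i = j then \<epsilon> i else 0)"

definition conformal_metric ::
    "('a \<Rightarrow> real) \<Rightarrow> ('a, 'i, 'k::finite) tensor2 \<Rightarrow> ('a, 'i, 'k) tensor2" where
  "conformal_metric \<phi> g = (\<lambda>i p. (1 / (\<phi> p)\<^sup>2) *\<^sub>R g i p)"

definition function_of_xi :: "real^'n::finite \<Rightarrow> (real^'n \<Rightarrow> real) \<Rightarrow> bool" where
  "function_of_xi \<alpha> u \<longleftrightarrow> (\<exists>u0 :: real \<Rightarrow> real. \<forall>x. u x = u0 (\<Sum>k\<in>UNIV. \<alpha> $ k * x $ k))"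

end

theory Submission
  imports Defs
begin

text \<open>
  A function of \<open>\<xi>\<close> has a null gradient: its \<open>g\<close>-gradient is a multiple of \<open>(\<epsilon>\<^sub>k \<alpha>\<^sub>k)\<close>, and \<open>\<Sum>\<^sub>k \<epsilon>\<^sub>k \<alpha>\<^sub>k\<^sup>2 = 0\<close>. Every contraction of two first derivatives, and every
  Laplacian, of functions of \<open>\<xi>\<close> therefore vanishes. This has two consequences for the warped
  product.

  First, its scalar curvature is that of the fibre, divided by the square of the warping
  function (\<open>scalar_curvature_warped\<close>). The conformal factor and the warping function contribute
  only multiples of \<open>\<alpha>\<^sub>i \<alpha>\<^sub>j\<close> to the Ricci tensor of the base directions (\<open>ricci_base\<close>), which are
  trace-free, and contribute nothing to the Ricci tensor of the fibre directions
  (\<open>ricci_fibre\<close>).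

  Secondly, the Hessian of the potential vanishes on pairs of vectors tangent to the fibre, since
  there it equals the inner product of the gradients of \<open>f\<close> and \<open>h\<close> times \<open>f g\<^sub>F\<close>
  (\<open>hessian_fibre_eq_0\<close>).

  The soliton equation on the fibre directions thus reads
  \<open>(\<lambda>\<^sub>F / f\<^sup>2 - \<rho>) f\<^sup>2 g\<^sub>F = 0\<close>. As \<open>g\<^sub>F\<close> is nondegenerate, \<open>\<lambda>\<^sub>F = \<rho> f\<^sup>2\<close>
  (\<open>fibre_curvature_of_lightlike_soliton\<close>), so \<open>\<rho>\<close> has the sign of \<open>\<lambda>\<^sub>F\<close>.

  All curvature quantities are computed in one product chart. There the metric has the form
  \<open>p(\<xi>) \<epsilon> \<oplus> q(\<xi>) K\<close> with \<open>K\<close> the fibre metric in its chart; the locale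
  \<open>lightlike_warped_coordinates\<close> fixes this situation.
\<close>

section \<open>Partial derivatives in product coordinates\<close>

lemma sum_UNIV_sum_type:
  fixes t :: "'n::finite + 'm::finite \<Rightarrow> 'c::comm_monoid_add"
  shows "(\<Sum>c\<in>UNIV. t c) = (\<Sum>i\<in>UNIV. t (Inl i)) + (\<Sum>a\<in>UNIV. t (Inr a))"
  by (subst UNIV_Plus_UNIV[symmetric], subst sum.Plus) (auto simp: o_def)

definition left_coords :: "real^('n::finite + 'm::finite) \<Rightarrow> real^'n" where
  "left_coords y = (\<chi> i. y $ Inl i)"

definition right_coords :: "real^('n::finite + 'm::finite) \<Rightarrow> real^'m" where
  "right_coords y = (\<chi> a. y $ Inr a)"

lemma left_coords_join [simp]: "left_coords (join_coords x z) = x"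
  by (simp add: left_coords_def join_coords_def vec_eq_iff)

lemma right_coords_join [simp]: "right_coords (join_coords x z) = z"
  by (simp add: right_coords_def join_coords_def vec_eq_iff)

lemma join_left_right [simp]: "join_coords (left_coords y) (right_coords y) = y"
  by (simp add: left_coords_def right_coords_def join_coords_def vec_eq_iff split: sum.splits)

lemma left_coords_line [simp]:
  "left_coords (y + t *\<^sub>R axis (Inl i) 1) = left_coords y + t *\<^sub>R axis i 1"
  "left_coords (y + t *\<^sub>R axis (Inr a) 1) = left_coords y"
  by (simp_all add: left_coords_def axis_def vec_eq_iff)

lemma right_coords_line [simp]:
  "right_coords (y + t *\<^sub>R axis (Inl i) 1) = right_coords y"
  "right_coords (y + t *\<^sub>R axis (Inr a) 1) = right_coords y + t *\<^sub>R axis a 1"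
  by (simp_all add: right_coords_def axis_def vec_eq_iff)

lemma open_right_coords_vimage: "open V \<Longrightarrow> open {y. right_coords y \<in> V}"
  unfolding right_coords_def
  by (rule open_vimage[unfolded vimage_def]) (auto intro!: continuous_intros)

lemma eventually_on_line:
  fixes S :: "(real^'k::finite) set"
  assumes "open S" "y \<in> S"
  shows "\<forall>\<^sub>F t in nhds 0. y + t *\<^sub>R axis a 1 \<in> S"
proof -
  have "open ((\<lambda>t. y + t *\<^sub>R axis a 1) -` S)"
    using assms(1) by (rule open_vimage) (auto intro!: continuous_intros)
  then show ?thesis
    using eventually_nhds_in_open[of "(\<lambda>t. y + t *\<^sub>R axis a 1) -` S" 0] assms(2) by simp
qed

text \<open>
  A chart determines the metric components on an open set only, and outside of it they are
  arbitrary. This lemma lets derivatives be taken of the formula that holds on that set.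
\<close>

lemma partial_cong_on_open:
  assumes "open S" "y \<in> S" "\<And>z. z \<in> S \<Longrightarrow> u z = w z"
  shows "partial a u y = partial a w y"
proof -
  have "\<forall>\<^sub>F t in nhds 0. u (y + t *\<^sub>R axis a 1) = w (y + t *\<^sub>R axis a 1)"
    using eventually_on_line[OF assms(1,2), of a] by (rule eventually_mono) (rule assms(3))
  then show ?thesis
    unfolding partial_def by (rule deriv_cong_ev) simp
qed

lemma partial_const [simp]: "partial a (\<lambda>y. c) y = 0"
  by (simp add: partial_def)

lemma has_partial_derivative:
  assumes "u differentiable (at y)"
  shows "((\<lambda>t. u (y + t *\<^sub>R axis a 1)) has_real_derivative partial a u y) (at 0)"
proof -
  have "(\<lambda>t. u (y + t *\<^sub>R axis a 1)) differentiable (at 0)"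
    using differentiable_chain_at[of "\<lambda>t. y + t *\<^sub>R axis a 1" 0 u] assms
    by (auto simp: o_def intro!: derivative_intros)
  then show ?thesis
    unfolding partial_def using DERIV_deriv_iff_real_differentiable by blast
qed

lemma has_derivative_along_xi:
  assumes "(A has_real_derivative A') (at (\<alpha> \<bullet> x))"
  shows "((\<lambda>t. A (\<alpha> \<bullet> (x + t *\<^sub>R axis i 1))) has_real_derivative A' * \<alpha> $ i) (at 0)"
proof -
  have "((\<lambda>t. \<alpha> \<bullet> (x + t *\<^sub>R axis i 1)) has_real_derivative \<alpha> $ i) (at 0)"
    by (auto simp: inner_add_right inner_axis intro!: derivative_eq_intros)
  then show ?thesis
    using DERIV_chain2[of A A' "\<lambda>t. \<alpha> \<bullet> (x + t *\<^sub>R axis i 1)" 0 "\<alpha> $ i" UNIV] assms by simp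
qed

text \<open>
  Differentiating in a base direction treats the fibre factor as a constant, so \<open>B\<close> may be any
  function here. In a fibre direction \<open>B\<close> has to be differentiable: \<open>deriv\<close> of a function that is
  not differentiable is an unspecified number, which does not scale with a factor.
\<close>

lemma partial_left_split:
  assumes "(A has_real_derivative A') (at (\<alpha> \<bullet> left_coords y))"
  shows "partial (Inl i) (\<lambda>y. A (\<alpha> \<bullet> left_coords y) * B (right_coords y)) y
           = A' * \<alpha> $ i * B (right_coords y)"
  unfolding partial_def
  by (rule DERIV_imp_deriv) (auto intro!: derivative_eq_intros has_derivative_along_xi[OF assms])

lemma partial_left_xi:
  assumes "(A has_real_derivative A') (at (\<alpha> \<bullet> left_coords y))"
  shows "partial (Inl i) (\<lambda>y. A (\<alpha> \<bullet> left_coords y) * c) y = A' * \<alpha> $ i * c"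
  using partial_left_split[OF assms, where B = "\<lambda>_. c"] by simp

lemma partial_right_of_left [simp]: "partial (Inr a) (\<lambda>y. A (left_coords y)) y = 0"
  by (simp add: partial_def)

lemma partial_right_of_right [simp]:
  "partial (Inr a) (\<lambda>y. B (right_coords y)) y = partial a B (right_coords y)"
  by (simp add: partial_def)

lemma partial_right_split:
  assumes "B differentiable (at (right_coords y))"
  shows "partial (Inr a) (\<lambda>y. A (left_coords y) * B (right_coords y)) y
           = A (left_coords y) * partial a B (right_coords y)"
proof -
  have "((\<lambda>t. B (right_coords y + t *\<^sub>R axis a 1)) has_real_derivative
           partial a B (right_coords y)) (at 0)"
    by (rule has_partial_derivative[OF assms])
  then show ?thesis
    unfolding partial_def[of "Inr a"]
    by (intro DERIV_imp_deriv) (auto intro!: derivative_eq_intros)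
qed

section \<open>Curvature of a lightlike warped product in coordinates\<close>

lemma matrix_inv_mult:
  fixes A :: "real^'k::finite^'k"
  assumes "invertible A"
  shows "A ** matrix_inv A = mat 1" "matrix_inv A ** A = mat 1"
  using someI_ex[OF assms[unfolded invertible_def]] by (auto simp: matrix_inv_def)

lemma matrix_inv_eqI:
  fixes A :: "real^'k::finite^'k"
  assumes "A ** B = mat 1"
  shows "matrix_inv A = B"
proof -
  have "invertible A"
    using assms matrix_left_right_inverse invertible_def by blast
  then have "matrix_inv A = matrix_inv A ** (A ** B)"
    by (simp add: assms)
  also have "\<dots> = B"
    using \<open>invertible A\<close> by (simp add: matrix_mul_assoc matrix_inv_mult)
  finally show ?thesis .
qed

text \<open>
  \<open>K\<close> is the metric of the fibre in a chart with image \<open>V\<close>; \<open>p\<close> and \<open>q\<close> stand for \<open>1/\<phi>\<^sup>2\<close> and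
  \<open>f\<^sup>2\<close> as functions of \<open>\<xi>\<close>. They enter the curvature through their first two derivatives only.
\<close>

locale lightlike_warped_coordinates =
  fixes \<epsilon> :: "'n::finite \<Rightarrow> real"
    and \<alpha> :: "real^'n"
    and p p' q q' :: "real \<Rightarrow> real"
    and K :: "real^'m::finite \<Rightarrow> real^'m^'m"
    and V :: "(real^'m) set"
    and G :: "real^('n + 'm) \<Rightarrow> real^('n + 'm)^('n + 'm)"
  assumes signs: "\<epsilon> i * \<epsilon> i = 1"
    and lightlike: "(\<Sum>k\<in>UNIV. \<epsilon> k * (\<alpha> $ k)\<^sup>2) = 0"
    and p_deriv: "(p has_real_derivative p' t) (at t)"
    and q_deriv: "(q has_real_derivative q' t) (at t)"
    and p'_diff: "p' field_differentiable at t"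
    and q'_diff: "q' field_differentiable at t"
    and p_nz: "p t \<noteq> 0"
    and q_nz: "q t \<noteq> 0"
    and open_V: "open V"
    and K_diff: "z \<in> V \<Longrightarrow> (\<lambda>z. K z $ a $ b) differentiable (at z)"
    and K_sym: "z \<in> V \<Longrightarrow> K z $ a $ b = K z $ b $ a"
    and K_inv: "z \<in> V \<Longrightarrow> invertible (K z)"
    and G_eq: "right_coords y \<in> V \<Longrightarrow> G y $ c $ d =
       (case (c, d) of
          (Inl i, Inl j) \<Rightarrow> p (\<alpha> \<bullet> left_coords y) * (if i = j then \<epsilon> i else 0)
        | (Inr a, Inr b) \<Rightarrow> q (\<alpha> \<bullet> left_coords y) * K (right_coords y) $ a $ b
        | _ \<Rightarrow> 0)"
begin

abbreviation U where "U \<equiv> {y :: real^('n + 'm). right_coords y \<in> V}"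

abbreviation \<xi> where "\<xi> (y :: real^('n + 'm)) \<equiv> \<alpha> \<bullet> left_coords y"

lemma open_U: "open U"
  by (rule open_right_coords_vimage[OF open_V])

lemmas partial_U = partial_cong_on_open[OF open_U]

text \<open>
  Half the logarithmic derivatives of the two factors, and the mixed quotient, are the only
  functions of \<open>\<xi>\<close> that occur in the Christoffel symbols.
\<close>

definition u where "u t = p' t / (2 * p t)"
definition v where "v t = q' t / (2 * p t)"
definition w where "w t = q' t / (2 * q t)"

lemma uvw_deriv:
  "(u has_real_derivative deriv u t) (at t)"
  "(v has_real_derivative deriv v t) (at t)"
  "(w has_real_derivative deriv w t) (at t)"
proof -
  have pq: "p field_differentiable at t" "q field_differentiable at t"
    using p_deriv q_deriv field_differentiable_def by blast+
  show "(u has_real_derivative deriv u t) (at t)"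
    "(v has_real_derivative deriv v t) (at t)"
    "(w has_real_derivative deriv w t) (at t)"
    unfolding DERIV_deriv_iff_field_differentiable u_def[abs_def] v_def[abs_def] w_def[abs_def]
    using p'_diff q'_diff p_nz q_nz pq
    by (auto intro!: field_differentiable_divide field_differentiable_mult)
qed

text \<open>
  The lightlike condition in the shape in which it occurs below, where one factor comes from a
  gradient with lower index and the other from one with raised index.
\<close>

lemma lightlike_mult:
  "(\<Sum>k\<in>UNIV. \<alpha> $ k * (\<epsilon> k * \<alpha> $ k)) = 0"
  "(\<Sum>k\<in>UNIV. c * (\<alpha> $ k * (\<epsilon> k * \<alpha> $ k))) = 0"
  using lightlike by (simp_all add: power2_eq_square ac_simps flip: sum_distrib_left)

lemma partial_G:
  assumes "y \<in> U"
  shows "partial (Inl k) (\<lambda>z. G z $ Inl i $ Inl j) y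
           = p' (\<xi> y) * \<alpha> $ k * (if i = j then \<epsilon> i else 0)"
    and "partial (Inr a) (\<lambda>z. G z $ Inl i $ Inl j) y = 0"
    and "partial c (\<lambda>z. G z $ Inl i $ Inr b) y = 0"
    and "partial c (\<lambda>z. G z $ Inr b $ Inl i) y = 0"
    and "partial (Inl k) (\<lambda>z. G z $ Inr a $ Inr b) y
           = q' (\<xi> y) * \<alpha> $ k * K (right_coords y) $ a $ b"
    and "partial (Inr d) (\<lambda>z. G z $ Inr a $ Inr b) y
           = q (\<xi> y) * partial d (\<lambda>z. K z $ a $ b) (right_coords y)"
proof -
  show "partial (Inl k) (\<lambda>z. G z $ Inl i $ Inl j) y
           = p' (\<xi> y) * \<alpha> $ k * (if i = j then \<epsilon> i else 0)"
    by (subst partial_U[OF assms, where w = "\<lambda>y. p (\<xi> y) * (if i = j then \<epsilon> i else 0)"])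
       (auto simp: G_eq partial_left_xi[OF p_deriv])
  show "partial (Inr a) (\<lambda>z. G z $ Inl i $ Inl j) y = 0"
    by (subst partial_U[OF assms, where w = "\<lambda>y. p (\<xi> y) * (if i = j then \<epsilon> i else 0)"])
       (auto simp: G_eq partial_right_of_left[where A = "\<lambda>x. p (\<alpha> \<bullet> x) * c" for c])
  show "partial c (\<lambda>z. G z $ Inl i $ Inr b) y = 0"
    by (subst partial_U[OF assms, where w = "\<lambda>_. 0"]) (auto simp: G_eq)
  show "partial c (\<lambda>z. G z $ Inr b $ Inl i) y = 0"
    by (subst partial_U[OF assms, where w = "\<lambda>_. 0"]) (auto simp: G_eq)
  have GF: "partial c (\<lambda>z. G z $ Inr a $ Inr b) y
        = partial c (\<lambda>y. q (\<xi> y) * K (right_coords y) $ a $ b) y" for c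
    by (rule partial_U[OF assms]) (auto simp: G_eq)
  show "partial (Inl k) (\<lambda>z. G z $ Inr a $ Inr b) y
           = q' (\<xi> y) * \<alpha> $ k * K (right_coords y) $ a $ b"
    unfolding GF by (rule partial_left_split[OF q_deriv, where B = "\<lambda>z. K z $ a $ b"])
  show "partial (Inr d) (\<lambda>z. G z $ Inr a $ Inr b) y
           = q (\<xi> y) * partial d (\<lambda>z. K z $ a $ b) (right_coords y)"
    unfolding GF using assms K_diff
    by (intro partial_right_split[where A = "\<lambda>x. q (\<alpha> \<bullet> x)" and B = "\<lambda>z. K z $ a $ b"]) auto
qed

lemma matrix_inv_G:
  assumes "y \<in> U"
  shows "matrix_inv (G y) $ c $ d =
       (case (c, d) of
          (Inl i, Inl j) \<Rightarrow> (if i = j then \<epsilon> i / p (\<xi> y) else 0)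
        | (Inr a, Inr b) \<Rightarrow> matrix_inv (K (right_coords y)) $ a $ b / q (\<xi> y)
        | _ \<Rightarrow> 0)"
proof -
  have KK: "(\<Sum>e\<in>UNIV. K (right_coords y) $ a $ e * matrix_inv (K (right_coords y)) $ e $ b)
              = (if a = b then 1 else 0)" for a b
    using matrix_inv_mult(1)[OF K_inv] assms
    by (simp add: vec_eq_iff matrix_matrix_mult_def mat_def)
  let ?B = "\<chi> c d. case (c, d) of
          (Inl i, Inl j) \<Rightarrow> (if i = j then \<epsilon> i / p (\<xi> y) else 0)
        | (Inr a, Inr b) \<Rightarrow> matrix_inv (K (right_coords y)) $ a $ b / q (\<xi> y)
        | _ \<Rightarrow> 0"
  have y: "right_coords y \<in> V" using assms by simp
  have "(G y ** ?B) $ c $ d = mat 1 $ c $ d" for c d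
  proof (cases c; cases d)
    fix i j assume "c = Inl i" "d = Inl j"
    then show ?thesis
      using signs p_nz[of "\<xi> y"]
      by (simp add: matrix_matrix_mult_def mat_def sum_UNIV_sum_type G_eq[OF y] if_distribR
            if_distrib[of "\<lambda>x. _ * x"] if_distrib[of "\<lambda>x. x * _"] cong: if_cong)
  next
    fix a b assume "c = Inr a" "d = Inr b"
    then show ?thesis
      using q_nz[of "\<xi> y"]
      by (simp add: matrix_matrix_mult_def mat_def sum_UNIV_sum_type G_eq[OF y] KK)
  qed (simp_all add: matrix_matrix_mult_def mat_def sum_UNIV_sum_type G_eq[OF y])
  then have "matrix_inv (G y) = ?B"
    by (intro matrix_inv_eqI) (simp add: vec_eq_iff)
  then show ?thesis by simp
qed

lemma christoffel_Inl:
  assumes "y \<in> U"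
  shows "christoffel G (Inl k) c d y =
     \<epsilon> k / (2 * p (\<xi> y)) *
       (partial c (\<lambda>z. G z $ d $ Inl k) y + partial d (\<lambda>z. G z $ c $ Inl k) y
         - partial (Inl k) (\<lambda>z. G z $ c $ d) y)"
  by (simp add: christoffel_def sum_UNIV_sum_type matrix_inv_G[OF assms] if_distribR
        if_distrib[of "\<lambda>x. x * _"] cong: if_cong)

lemma christoffel_Inr:
  assumes "y \<in> U"
  shows "christoffel G (Inr a) c d y =
     (\<Sum>e\<in>UNIV. matrix_inv (K (right_coords y)) $ a $ e *
       (partial c (\<lambda>z. G z $ d $ Inr e) y + partial d (\<lambda>z. G z $ c $ Inr e) y
         - partial (Inr e) (\<lambda>z. G z $ c $ d) y)) / (2 * q (\<xi> y))"
  by (simp add: christoffel_def sum_UNIV_sum_type matrix_inv_G[OF assms] sum_divide_distrib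
        mult.commute[of 2])

text \<open>
  The constant factor in the base Christoffel symbols. For a conformal change of a flat metric
  they are \<open>\<delta>\<^sub>j\<^sub>k \<partial>\<^sub>i\<sigma> + \<delta>\<^sub>i\<^sub>k \<partial>\<^sub>j\<sigma> - g\<^sub>i\<^sub>j g\<^sup>k\<^sup>k \<partial>\<^sub>k\<sigma>\<close> with \<open>2\<sigma> = ln \<bar>p\<bar>\<close>, and here
  \<open>\<partial>\<^sub>i\<sigma> = u(\<xi>) \<alpha>\<^sub>i\<close>.
\<close>

definition base_coeff where
  "base_coeff k i j = (if j = k then \<alpha> $ i else 0) + (if i = k then \<alpha> $ j else 0)
                        - (if i = j then \<epsilon> i * (\<epsilon> k * \<alpha> $ k) else 0)"

lemma base_coeff_trace [simp]: "base_coeff k k i = \<alpha> $ i" "base_coeff k i k = \<alpha> $ i"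
  using signs by (auto simp: base_coeff_def simp flip: mult.assoc)

text \<open>
  Of the three terms, the one carrying the metric produces \<open>\<Sum>\<^sub>l \<epsilon>\<^sub>l \<alpha>\<^sub>l\<^sup>2\<close> and drops out. What is
  left is a multiple of \<open>\<alpha>\<^sub>i\<^sup>2\<close>, and likewise for the quadratic expression after it.
\<close>

lemma base_coeff_divergence:
  "(\<Sum>l\<in>UNIV. \<alpha> $ l * base_coeff l i i) = 2 * (\<alpha> $ i)\<^sup>2"
proof -
  have "(\<Sum>l\<in>UNIV. \<alpha> $ l * base_coeff l i i)
      = (\<Sum>l\<in>UNIV. if i = l then 2 * (\<alpha> $ i)\<^sup>2 else 0)
        - (\<Sum>l\<in>UNIV. \<epsilon> i * (\<alpha> $ l * (\<epsilon> l * \<alpha> $ l)))"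
    unfolding sum_subtractf[symmetric]
    by (rule sum.cong) (auto simp: base_coeff_def power2_eq_square algebra_simps)
  then show ?thesis by (simp add: lightlike_mult)
qed

lemma base_coeff_quadratic:
  "(\<Sum>k\<in>UNIV. \<Sum>l\<in>UNIV. base_coeff k i l * base_coeff l k i)
     = (real CARD('n) + 2) * (\<alpha> $ i)\<^sup>2"
proof -
  have inner: "(\<Sum>l\<in>UNIV. base_coeff k i l * base_coeff l k i)
      = (\<alpha> $ i)\<^sup>2 + (if i = k then 2 * (\<alpha> $ i)\<^sup>2 else 0)
          - \<epsilon> i * (\<alpha> $ k * (\<epsilon> k * \<alpha> $ k))" for k
  proof -
    \<comment> \<open>Expanding only the first factor keeps the number of terms small: its Kronecker deltas
        turn the second factor into one of the traces computed above.\<close>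
    have "base_coeff k i l * base_coeff l k i
        = (if l = k then \<alpha> $ i * base_coeff l k i else 0)
          + (if i = k then \<alpha> $ l * base_coeff l i i else 0)
          - (if i = l then \<epsilon> i * (\<epsilon> k * \<alpha> $ k) * base_coeff l k i else 0)" for l
      unfolding base_coeff_def[of k i]
      by (cases "l = k"; cases "i = k"; cases "i = l") (simp_all add: distrib_right left_diff_distrib)
    then have "(\<Sum>l\<in>UNIV. base_coeff k i l * base_coeff l k i)
        = (\<Sum>l\<in>UNIV. if l = k then \<alpha> $ i * base_coeff l k i else 0)
          + (\<Sum>l\<in>UNIV. if i = k then \<alpha> $ l * base_coeff l i i else 0)
          - (\<Sum>l\<in>UNIV. if i = l then \<epsilon> i * (\<epsilon> k * \<alpha> $ k) * base_coeff l k i else 0)"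
      by (simp only: sum.distrib sum_subtractf)
    also have "\<dots> = (\<alpha> $ i)\<^sup>2 + (if i = k then 2 * (\<alpha> $ i)\<^sup>2 else 0)
          - \<epsilon> i * (\<alpha> $ k * (\<epsilon> k * \<alpha> $ k))"
      by (simp add: base_coeff_divergence power2_eq_square)
    finally show ?thesis .
  qed
  show ?thesis
    unfolding inner sum.distrib sum_subtractf lightlike_mult(2) by (simp add: algebra_simps)
qed

lemma christoffel_base:
  assumes "y \<in> U"
  shows "christoffel G (Inl k) (Inl i) (Inl j) y = u (\<xi> y) * base_coeff k i j"
  using signs[of k] p_nz[of "\<xi> y"]
  by (simp add: christoffel_Inl[OF assms] partial_G[OF assms] u_def base_coeff_def field_simps)

text \<open>
  The index order on \<open>K\<close> is the one occurring in \<open>christoffel\<close>. It is transposed with respect to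
  the matrix product, and symmetry of the fibre metric makes up for that.
\<close>

lemma K_inv_contract:
  assumes "y \<in> U"
  shows "(\<Sum>e\<in>UNIV. matrix_inv (K (right_coords y)) $ a $ e * K (right_coords y) $ b $ e)
           = (if a = b then 1 else 0)"
proof -
  have "(\<Sum>e\<in>UNIV. matrix_inv (K (right_coords y)) $ a $ e * K (right_coords y) $ b $ e)
      = (matrix_inv (K (right_coords y)) ** K (right_coords y)) $ a $ b"
    using assms K_sym by (simp add: matrix_matrix_mult_def)
  then show ?thesis
    using assms by (simp add: matrix_inv_mult K_inv mat_def)
qed

lemma christoffel_mixed:
  assumes "y \<in> U"
  shows "christoffel G (Inl k) (Inl i) (Inr b) y = 0"
    and "christoffel G (Inl k) (Inr b) (Inl i) y = 0"
    and "christoffel G (Inr a) (Inl i) (Inl j) y = 0"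
    and "christoffel G (Inl k) (Inr a) (Inr b) y
           = v (\<xi> y) * (- (\<epsilon> k * \<alpha> $ k) * K (right_coords y) $ a $ b)"
    and "christoffel G (Inr a) (Inl i) (Inr b) y = w (\<xi> y) * (if a = b then \<alpha> $ i else 0)"
    and "christoffel G (Inr a) (Inr b) (Inl i) y = w (\<xi> y) * (if a = b then \<alpha> $ i else 0)"
    and "christoffel G (Inr c) (Inr a) (Inr b) y = christoffel K c a b (right_coords y)"
proof -
  show "christoffel G (Inl k) (Inl i) (Inr b) y = 0"
    and "christoffel G (Inl k) (Inr b) (Inl i) y = 0"
    and "christoffel G (Inr a) (Inl i) (Inl j) y = 0"
    and "christoffel G (Inl k) (Inr a) (Inr b) y
           = v (\<xi> y) * (- (\<epsilon> k * \<alpha> $ k) * K (right_coords y) $ a $ b)"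
    by (simp_all add: christoffel_Inl[OF assms] christoffel_Inr[OF assms] partial_G[OF assms] v_def)
  have "(\<Sum>e\<in>UNIV. matrix_inv (K (right_coords y)) $ a $ e *
           (q' (\<xi> y) * \<alpha> $ i * K (right_coords y) $ b $ e))
         = q' (\<xi> y) * \<alpha> $ i * (if a = b then 1 else 0)"
    unfolding K_inv_contract[OF assms, symmetric] sum_distrib_left by (simp add: ac_simps)
  then show "christoffel G (Inr a) (Inl i) (Inr b) y = w (\<xi> y) * (if a = b then \<alpha> $ i else 0)"
    and "christoffel G (Inr a) (Inr b) (Inl i) y = w (\<xi> y) * (if a = b then \<alpha> $ i else 0)"
    by (simp_all add: christoffel_Inr[OF assms] partial_G[OF assms] w_def)
  show "christoffel G (Inr c) (Inr a) (Inr b) y = christoffel K c a b (right_coords y)"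
    using q_nz[of "\<xi> y"]
    by (simp add: christoffel_Inr[OF assms] partial_G[OF assms] christoffel_def[of K]
        mult.left_commute[of _ "q _"]
        flip: sum_distrib_left distrib_left right_diff_distrib)
qed

lemma partial_christoffel:
  assumes "y \<in> U"
  shows "partial (Inl l) (christoffel G (Inl k) (Inl i) (Inl j)) y
           = deriv u (\<xi> y) * \<alpha> $ l * base_coeff k i j"
    and "partial c (christoffel G (Inl k) (Inl i) (Inr b)) y = 0"
    and "partial c (christoffel G (Inr a) (Inl i) (Inl j)) y = 0"
    and "partial (Inl l) (christoffel G (Inl k) (Inr a) (Inr b)) y
           = deriv v (\<xi> y) * \<alpha> $ l * (- (\<epsilon> k * \<alpha> $ k) * K (right_coords y) $ a $ b)"
    and "partial (Inl l) (christoffel G (Inr a) (Inr b) (Inl i)) y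
           = deriv w (\<xi> y) * \<alpha> $ l * (if a = b then \<alpha> $ i else 0)"
    and "partial (Inr d) (christoffel G (Inr e) (Inr a) (Inr b)) y
           = partial d (christoffel K e a b) (right_coords y)"
proof -
  show "partial (Inl l) (christoffel G (Inl k) (Inl i) (Inl j)) y
           = deriv u (\<xi> y) * \<alpha> $ l * base_coeff k i j"
    by (subst partial_U[OF assms, where w = "\<lambda>y. u (\<xi> y) * base_coeff k i j"])
       (auto simp: christoffel_base partial_left_xi[OF uvw_deriv(1)])
  show "partial c (christoffel G (Inl k) (Inl i) (Inr b)) y = 0"
    by (subst partial_U[OF assms, where w = "\<lambda>y. 0"]) (auto simp: christoffel_mixed)
  show "partial c (christoffel G (Inr a) (Inl i) (Inl j)) y = 0"
    by (subst partial_U[OF assms, where w = "\<lambda>y. 0"]) (auto simp: christoffel_mixed)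
  have "partial (Inl l) (christoffel G (Inl k) (Inr a) (Inr b)) y
    = partial (Inl l) (\<lambda>y. v (\<xi> y) * (- (\<epsilon> k * \<alpha> $ k) * K (right_coords y) $ a $ b)) y"
    by (rule partial_U[OF assms]) (auto simp: christoffel_mixed)
  then show "partial (Inl l) (christoffel G (Inl k) (Inr a) (Inr b)) y
           = deriv v (\<xi> y) * \<alpha> $ l * (- (\<epsilon> k * \<alpha> $ k) * K (right_coords y) $ a $ b)"
    using partial_left_split[OF uvw_deriv(2),
        where B = "\<lambda>z. - (\<epsilon> k * \<alpha> $ k) * K z $ a $ b"] by simp
  show "partial (Inl l) (christoffel G (Inr a) (Inr b) (Inl i)) y
           = deriv w (\<xi> y) * \<alpha> $ l * (if a = b then \<alpha> $ i else 0)"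
    by (subst partial_U[OF assms, where w = "\<lambda>y. w (\<xi> y) * (if a = b then \<alpha> $ i else 0)"])
       (auto simp: christoffel_mixed partial_left_xi[OF uvw_deriv(3)])
  show "partial (Inr d) (christoffel G (Inr e) (Inr a) (Inr b)) y
           = partial d (christoffel K e a b) (right_coords y)"
    by (subst partial_U[OF assms, where w = "\<lambda>y. christoffel K e a b (right_coords y)"])
       (auto simp: christoffel_mixed)
qed

text \<open>
  The coefficient of \<open>\<alpha>\<^sub>i \<alpha>\<^sub>j\<close> in the Ricci tensor of the base directions. Since it depends
  on \<open>\<xi>\<close> alone, it factors out of the trace and leaves the lightlike sum.
\<close>

definition ricci_profile where
  "ricci_profile t =
     (2 - real CARD('n)) * deriv u t + (real CARD('n) - 2) * (u t)\<^sup>2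
     + real CARD('m) * (2 * u t * w t - deriv w t - (w t)\<^sup>2)"

text \<open>
  The diagonal components suffice, because the metric of the base is diagonal.
\<close>

lemma ricci_base:
  assumes "y \<in> U"
  shows "ricci G (Inl i) (Inl i) y = ricci_profile (\<xi> y) * (\<alpha> $ i)\<^sup>2"
proof -
  note ch = christoffel_base[OF assms] christoffel_mixed[OF assms] partial_christoffel[OF assms]
  let ?t = "\<xi> y"
  have base: "(\<Sum>k\<in>UNIV. riemann G (Inl k) (Inl i) (Inl k) (Inl i) y)
      = deriv u ?t * (\<Sum>k\<in>UNIV. \<alpha> $ k * base_coeff k i i)
        - real CARD('n) * deriv u ?t * (\<alpha> $ i)\<^sup>2
        + real CARD('n) * (u ?t)\<^sup>2 * (\<Sum>l\<in>UNIV. \<alpha> $ l * base_coeff l i i)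
        - (u ?t)\<^sup>2 * (\<Sum>k\<in>UNIV. \<Sum>l\<in>UNIV. base_coeff k i l * base_coeff l k i)"
    by (simp add: riemann_def sum_UNIV_sum_type ch sum.distrib sum_subtractf sum_distrib_left
          power2_eq_square algebra_simps)
  have fibre: "riemann G (Inr a) (Inl i) (Inr a) (Inl i) y
      = 2 * u ?t * w ?t * (\<alpha> $ i)\<^sup>2 - deriv w ?t * (\<alpha> $ i)\<^sup>2 - (w ?t)\<^sup>2 * (\<alpha> $ i)\<^sup>2" for a
  proof -
    have "(\<Sum>l\<in>UNIV. w ?t * \<alpha> $ l * (u ?t * base_coeff l i i)) 
        = w ?t * u ?t * (\<Sum>l\<in>UNIV. \<alpha> $ l * base_coeff l i i)"
      by (simp add: sum_distrib_left ac_simps)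
    moreover have "(\<Sum>b\<in>UNIV. w ?t * (if a = b then \<alpha> $ i else 0) * 
          (w ?t * (if b = a then \<alpha> $ i else 0))) = (w ?t)\<^sup>2 * (\<alpha> $ i)\<^sup>2"
      by (simp add: if_distrib[of "\<lambda>x. _ * x"] if_distrib[of "\<lambda>x. x * _"] power2_eq_square cong: if_cong)
    ultimately show ?thesis
      by (simp add: riemann_def sum_UNIV_sum_type ch sum_subtractf sum_negf base_coeff_divergence
          power2_eq_square)
  qed
  show ?thesis
    by (simp add: ricci_def sum_UNIV_sum_type base fibre base_coeff_divergence base_coeff_quadratic
        ricci_profile_def algebra_simps)
qed

text \<open>
  The warping function could change the Ricci tensor along the fibre only through its Laplacian
  and the norm of its gradient, both of which vanish.
\<close>

lemma ricci_fibre: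
  assumes "y \<in> U"
  shows "ricci G (Inr c) (Inr b) y = ricci K c b (right_coords y)"
proof -
  note ch = christoffel_base[OF assms] christoffel_mixed[OF assms] partial_christoffel[OF assms]
  let ?t = "\<xi> y" and ?K = "K (right_coords y) $ b $ c"
  have uvX: "(\<Sum>l\<in>UNIV. u ?t * base_coeff k k l * (v ?t * (- (\<epsilon> l * \<alpha> $ l) * x))) = 0" for x k
    using lightlike_mult(2)[of "- (u ?t * v ?t * x)"] by (simp add: ac_simps sum_negf)
  have vw: "(\<Sum>l\<in>UNIV. w ?t * \<alpha> $ l * (v ?t * (- (\<epsilon> l * \<alpha> $ l) * x))) = 0" for x
    using lightlike_mult(2)[of "- (w ?t * v ?t * x)"] by (simp add: ac_simps sum_negf)
  have vK: "(\<Sum>d\<in>UNIV. v ?t * (- (\<epsilon> k * \<alpha> $ k) * K (right_coords y) $ b $ d)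
        * (w ?t * (if d = c then \<alpha> $ k else 0)))
      = - (v ?t * w ?t * ?K * (\<alpha> $ k * (\<epsilon> k * \<alpha> $ k)))" for k
    by (simp add: if_distrib[of "\<lambda>x. _ * x"] cong: if_cong)
  have "riemann G (Inl k) (Inr c) (Inl k) (Inr b) y
      = (v ?t * w ?t - deriv v ?t) * ?K * (\<alpha> $ k * (\<epsilon> k * \<alpha> $ k))" for k
    unfolding riemann_def sum_UNIV_sum_type ch sum_subtractf mult_zero_left mult_zero_right
      sum.neutral_const uvX vK
    by (simp add: algebra_simps)
  then have base: "(\<Sum>k\<in>UNIV. riemann G (Inl k) (Inr c) (Inl k) (Inr b) y) = 0"
    by (simp add: lightlike_mult)
  have fibre: "riemann G (Inr a) (Inr c) (Inr a) (Inr b) y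
      = riemann K a c a b (right_coords y)" for a
    using vw
    by (cases "a = b") (simp_all add: riemann_def sum_UNIV_sum_type ch sum_subtractf)
  show ?thesis
    by (simp add: ricci_def sum_UNIV_sum_type base fibre)
qed

text \<open>
  Since the metric is block diagonal, the trace of the Ricci tensor splits into a base part and a
  fibre part. The base part is \<open>\<Sum>\<^sub>i \<epsilon>\<^sub>i \<alpha>\<^sub>i\<^sup>2\<close> times a function of \<open>\<xi>\<close>.
\<close>

theorem scalar_curvature_warped:
  assumes "y \<in> U"
  shows "scalar_coord G y = scalar_coord K (right_coords y) / q (\<xi> y)"
proof -
  have "(\<Sum>i\<in>UNIV. \<epsilon> i / p (\<xi> y) * (ricci_profile (\<xi> y) * (\<alpha> $ i)\<^sup>2)) = 0"
    using lightlike_mult(2)[of "ricci_profile (\<xi> y) / p (\<xi> y)"]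
    by (simp add: ac_simps power2_eq_square)
  then show ?thesis
    by (simp add: scalar_coord_def sum_UNIV_sum_type matrix_inv_G[OF assms] ricci_base[OF assms]
        ricci_fibre[OF assms] if_distrib[of "\<lambda>x. x * _"] sum_divide_distrib cong: if_cong)
qed

text \<open>
  The function \<open>H\<close> is constant along the fibre, so only the Christoffel symbols
  with a base upper index and two fibre lower indices contribute. They are proportional to
  \<open>\<epsilon>\<^sub>k \<alpha>\<^sub>k\<close> and meet the base gradient of \<open>H\<close>, which is proportional to \<open>\<alpha>\<^sub>k\<close>.
\<close>

lemma hessian_fibre_eq_0:
  assumes H: "\<And>z. z \<in> U \<Longrightarrow> H z = \<eta> (\<xi> z)"
    and \<eta>: "\<And>t. (\<eta> has_real_derivative \<eta>' t) (at t)"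
    and y: "y \<in> U"
  shows "partial (Inr a) (partial (Inr b) H) y
           - (\<Sum>c\<in>UNIV. christoffel G c (Inr a) (Inr b) y * partial c H y) = 0"
proof -
  have H': "partial c H z = partial c (\<lambda>z. \<eta> (\<xi> z)) z" if "z \<in> U" for c z
    by (rule partial_U[OF that]) (rule H)
  have fibre: "partial (Inr b) H z = 0" if "z \<in> U" for b z
    unfolding H'[OF that] by (rule partial_right_of_left)
  have base: "partial (Inl k) H y = \<eta>' (\<xi> y) * \<alpha> $ k" for k
    unfolding H'[OF y] using partial_left_xi[OF \<eta>, where c = 1] by simp
  have "partial (Inr a) (partial (Inr b) H) y = 0"
    using partial_U[OF y, of "partial (Inr b) H" "\<lambda>z. 0" "Inr a"] fibre partial_const by metis
  moreover have "(\<Sum>k\<in>UNIV. christoffel G (Inl k) (Inr a) (Inr b) y * partial (Inl k) H y) = 0"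
    using lightlike_mult(2)[of "- (v (\<xi> y) * K (right_coords y) $ a $ b * \<eta>' (\<xi> y))"]
    by (simp add: christoffel_mixed[OF y] base ac_simps sum_negf)
  ultimately show ?thesis
    by (simp add: sum_UNIV_sum_type fibre[OF y])
qed

end

section \<open>From the manifold to coordinates\<close>

text \<open>
  A function of \<open>\<xi>\<close> is given by some function of one variable, not assumed regular. As
  \<open>\<alpha> \<noteq> 0\<close>, it can be recovered as the restriction of the smooth function to a coordinate line on
  which \<open>\<xi>\<close> is the parameter, and so inherits smoothness.
\<close>

lemma smooth_function_of_xi_profile:
  assumes "smooth_on UNIV s" "function_of_xi \<alpha> s" "\<alpha> \<noteq> 0"
  obtains s0 s1 where "\<And>x. s x = s0 (\<alpha> \<bullet> x)"
    and "\<And>t. (s0 has_real_derivative s1 t) (at t)" "\<And>t. s1 field_differentiable at t"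
proof -
  obtain s0 where s0: "\<And>x. s x = s0 (\<alpha> \<bullet> x)"
    using assms(2) by (auto simp: function_of_xi_def inner_vec_def)
  obtain k where k: "\<alpha> $ k \<noteq> 0"
    using assms(3) by (auto simp: vec_eq_iff)
  define \<gamma> :: "real \<Rightarrow> real^'a" where "\<gamma> t = (t / \<alpha> $ k) *\<^sub>R axis k 1" for t
  have xi_\<gamma>: "\<alpha> \<bullet> \<gamma> t = t" for t
    using k by (simp add: \<gamma>_def inner_axis)
  have along: "((\<lambda>t. r (\<gamma> t)) has_real_derivative partial k r (\<gamma> t) / \<alpha> $ k) (at t)"
    if "\<And>x. r differentiable (at x)" for r t
  proof -
    have "((\<lambda>\<tau>. (\<tau> - t) / \<alpha> $ k) has_real_derivative 1 / \<alpha> $ k) (at t)"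
      using k by (auto intro!: derivative_eq_intros)
    then have "((\<lambda>\<tau>. r (\<gamma> t + ((\<tau> - t) / \<alpha> $ k) *\<^sub>R axis k 1)) has_real_derivative
            partial k r (\<gamma> t) * (1 / \<alpha> $ k)) (at t)"
      using has_partial_derivative[OF that, of "\<gamma> t" k]
      by (intro DERIV_chain2[where f = "\<lambda>s. r (\<gamma> t + s *\<^sub>R axis k 1)"
            and g = "\<lambda>\<tau>. (\<tau> - t) / \<alpha> $ k"]) simp_all
    moreover have "\<gamma> t + ((\<tau> - t) / \<alpha> $ k) *\<^sub>R axis k 1 = \<gamma> \<tau>" for \<tau>
      by (simp add: \<gamma>_def diff_divide_distrib flip: scaleR_add_left)
    ultimately show ?thesis by simp
  qed
  have "Ck_on 2 UNIV s" using assms(1) by (simp add: smooth_on_def)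
  then have diff: "\<And>x. s differentiable (at x)" "\<And>x. partial k s differentiable (at x)"
    by (auto simp: numeral_2_eq_2)
  have "s0 = (\<lambda>t. s (\<gamma> t))" by (simp add: s0 xi_\<gamma>)
  then have "\<And>t. (s0 has_real_derivative partial k s (\<gamma> t) / \<alpha> $ k) (at t)"
    using along[OF diff(1)] by simp
  moreover have "\<And>t. (\<lambda>t. partial k s (\<gamma> t) / \<alpha> $ k) field_differentiable at t"
    using DERIV_cdivide[OF along[OF diff(2)]] unfolding field_differentiable_def by blast
  ultimately show thesis
    using that[of s0 "\<lambda>t. partial k s (\<gamma> t) / \<alpha> $ k"] s0 by blast
qed

lemma chart_inv_product_manifold:
  assumes "inj_on (chart_map B i) (chart_dom B i)" "inj_on (chart_map F j) (chart_dom F j)"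
    and "left_coords y \<in> chart_image B i" "right_coords y \<in> chart_image F j"
  shows "chart_inv (product_manifold B F) (i, j) y
           = (chart_inv B i (left_coords y), chart_inv F j (right_coords y))"
  unfolding chart_inv_def
proof (rule inv_into_f_eq)
  show "inj_on (chart_map (product_manifold B F) (i, j)) (chart_dom (product_manifold B F) (i, j))"
  proof (rule inj_onI)
    fix P Q
    assume P: "P \<in> chart_dom (product_manifold B F) (i, j)"
      and Q: "Q \<in> chart_dom (product_manifold B F) (i, j)"
      and eq: "chart_map (product_manifold B F) (i, j) P = chart_map (product_manifold B F) (i, j) Q"
    have "chart_map B i (fst P) = chart_map B i (fst Q)" "chart_map F j (snd P) = chart_map F j (snd Q)"
      using arg_cong[OF eq, of left_coords] arg_cong[OF eq, of right_coords]
      by (auto simp: product_manifold_def split: prod.splits)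
    then show "P = Q"
      using P Q inj_onD[OF assms(1)] inj_onD[OF assms(2)]
      by (simp add: product_manifold_def mem_Times_iff prod_eq_iff)
  qed
qed (use assms(3,4) in \<open>auto simp: product_manifold_def chart_image_def f_inv_into_f
       intro: inv_into_into\<close>)

lemma euclidean_manifold_chart [simp]:
  "inj_on (chart_map euclidean_manifold i) (chart_dom euclidean_manifold i)"
  "chart_image euclidean_manifold i = UNIV"
  "chart_inv euclidean_manifold i y = y"
  by (simp_all add: chart_inv_def chart_image_def euclidean_manifold_def inv_into_f_eq)

lemma pseudo_riemannian_chart:
  assumes "pseudo_riemannian F g" "j \<in> charts F"
  shows "inj_on (chart_map F j) (chart_dom F j)" "open (chart_image F j)"
    and "z \<in> chart_image F j \<Longrightarrow> (\<lambda>z. local_comp F g j z $ a $ b) differentiable (at z)"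
    and "z \<in> chart_image F j \<Longrightarrow> local_comp F g j z $ a $ b = local_comp F g j z $ b $ a"
    and "z \<in> chart_image F j \<Longrightarrow> invertible (local_comp F g j z)"
proof -
  have "openin (mtop F) (chart_dom F j)"
    and hom: "homeomorphic_map (subtopology (mtop F) (chart_dom F j))
      (top_of_set (chart_image F j)) (chart_map F j)"
    and "open (chart_image F j)"
    using assms by (auto simp: pseudo_riemannian_def smooth_manifold_def)
  then show "inj_on (chart_map F j) (chart_dom F j)" "open (chart_image F j)"
    using homeomorphic_imp_injective_map[OF hom] openin_subset[of "mtop F" "chart_dom F j"]
    by (auto simp: inf_absorb2)
  have "smooth_on (chart_image F j) (\<lambda>y. local_comp F g j y $ a $ b)"
    using assms unfolding pseudo_riemannian_def by blast
  then have "Ck_on (Suc 0) (chart_image F j) (\<lambda>y. local_comp F g j y $ a $ b)"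
    unfolding smooth_on_def by blast
  then show "(\<lambda>z. local_comp F g j z $ a $ b) differentiable (at z)" if "z \<in> chart_image F j"
    using that by simp
  show "local_comp F g j z $ a $ b = local_comp F g j z $ b $ a"
    and "invertible (local_comp F g j z)" if "z \<in> chart_image F j"
  proof -
    have "chart_inv F j z \<in> chart_dom F j"
      using that by (simp add: chart_inv_def chart_image_def inv_into_into)
    then have *: "transpose (local_comp F g j z) = local_comp F g j z"
      and "invertible (local_comp F g j z)"
      using assms unfolding pseudo_riemannian_def local_comp_def by blast+
    then show "invertible (local_comp F g j z)" by simp
    show "local_comp F g j z $ a $ b = local_comp F g j z $ b $ a"
      using arg_cong[OF *, of "\<lambda>A. A $ b $ a"] by (simp add: transpose_def)
  qed
qed

section \<open>The soliton constant\<close>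

text \<open>
  It suffices to compare one nonzero component of the fibre metric in the soliton equation. The
  fibre is arbitrary but nonempty, so a chart around some point of it exists; the base point is
  free.
\<close>

lemma fibre_curvature_of_lightlike_soliton:
  fixes \<epsilon> :: "'n::finite \<Rightarrow> real" and \<alpha> :: "real^'n" and f \<phi> h :: "real^'n \<Rightarrow> real"
    and F :: "('b, 'j, 'm::finite) manifold" and g_F :: "('b, 'j, 'm) tensor2"
  assumes \<epsilon>: "\<And>i. \<epsilon> i \<in> {-1, 1}"
    and F: "pseudo_riemannian F g_F" "constant_scalar_curvature F g_F \<kappa>"
    and smooth: "smooth_on UNIV f" "smooth_on UNIV \<phi>" "smooth_on UNIV h"
    and nz: "\<And>x. f x \<noteq> 0" "\<And>x. \<phi> x \<noteq> 0"
    and xi: "function_of_xi \<alpha> f" "function_of_xi \<alpha> \<phi>" "function_of_xi \<alpha> h"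
    and \<alpha>: "\<alpha> \<noteq> 0" "(\<Sum>k\<in>UNIV. \<epsilon> k * (\<alpha> $ k)\<^sup>2) = 0"
    and soliton: "gradient_yamabe_soliton (product_manifold euclidean_manifold F)
      (warped_metric (conformal_metric \<phi> (pseudo_euclidean \<epsilon>)) f g_F) (\<lambda>(x, q). h x) \<rho>"
  shows "\<kappa> = \<rho> * (f x)\<^sup>2"
proof -
  define M where "M = product_manifold (euclidean_manifold :: (real^'n, unit, 'n) manifold) F"
  define gt where "gt = warped_metric (conformal_metric \<phi> (pseudo_euclidean \<epsilon>)) f g_F"
  obtain f0 f1 where f0: "\<And>x. f x = f0 (\<alpha> \<bullet> x)"
    "\<And>t. (f0 has_real_derivative f1 t) (at t)" "\<And>t. f1 field_differentiable at t"
    by (rule smooth_function_of_xi_profile[OF smooth(1) xi(1) \<alpha>(1)]) (rule that)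
  obtain \<phi>0 \<phi>1 where \<phi>0: "\<And>x. \<phi> x = \<phi>0 (\<alpha> \<bullet> x)"
    "\<And>t. (\<phi>0 has_real_derivative \<phi>1 t) (at t)" "\<And>t. \<phi>1 field_differentiable at t"
    by (rule smooth_function_of_xi_profile[OF smooth(2) xi(2) \<alpha>(1)]) (rule that)
  obtain h0 h1 where h0: "\<And>x. h x = h0 (\<alpha> \<bullet> x)" "\<And>t. (h0 has_real_derivative h1 t) (at t)"
    "\<And>t. h1 field_differentiable at t"
    by (rule smooth_function_of_xi_profile[OF smooth(3) xi(3) \<alpha>(1)]) (rule that)
  have xi_surj: "\<exists>x. \<alpha> \<bullet> x = t" for t
    using \<alpha>(1) by (intro exI[of _ "(t / (\<alpha> \<bullet> \<alpha>)) *\<^sub>R \<alpha>"]) simp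
  have nz0: "f0 t \<noteq> 0" "\<phi>0 t \<noteq> 0" for t
    using xi_surj[of t] nz by (auto simp: f0(1) \<phi>0(1))
  have "topspace (mtop F) \<noteq> {}" "(\<Union>i\<in>charts F. chart_dom F i) = topspace (mtop F)"
    using F(1) unfolding pseudo_riemannian_def smooth_manifold_def by blast+
  then obtain j q where j: "j \<in> charts F" and q: "q \<in> chart_dom F j"
    by blast
  note chart = pseudo_riemannian_chart[OF F(1) j]
  define G where "G = local_comp M gt ((), j)"
  define K where "K = local_comp F g_F j"
  define z where "z = chart_map F j q"
  have z: "z \<in> chart_image F j" and q_z: "chart_inv F j z = q"
    using q chart(1) by (auto simp: z_def chart_image_def chart_inv_def)
  have inv: "chart_inv M ((), j) y = (left_coords y, chart_inv F j (right_coords y))"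
    if "right_coords y \<in> chart_image F j" for y
    using that chart(1) by (simp add: M_def chart_inv_product_manifold)
  interpret lightlike_warped_coordinates \<epsilon> \<alpha>
    "\<lambda>t. 1 / (\<phi>0 t)\<^sup>2" "\<lambda>t. - 2 * \<phi>1 t / (\<phi>0 t) ^ 3" "\<lambda>t. (f0 t)\<^sup>2" "\<lambda>t. 2 * f0 t * f1 t"
    K "chart_image F j" G
  proof
    have diff: "f0 field_differentiable at t" "\<phi>0 field_differentiable at t" for t
      using f0(2) \<phi>0(2) field_differentiable_def by blast+
    show "\<epsilon> i * \<epsilon> i = 1" for i using \<epsilon>[of i] by auto
    show "((\<lambda>t. 1 / (\<phi>0 t)\<^sup>2) has_real_derivative - 2 * \<phi>1 t / (\<phi>0 t) ^ 3) (at t)" for t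
      using nz0 by (auto intro!: derivative_eq_intros \<phi>0(2) simp: power2_eq_square power3_eq_cube field_simps)
    show "((\<lambda>t. (f0 t)\<^sup>2) has_real_derivative 2 * f0 t * f1 t) (at t)" for t
      by (auto intro!: derivative_eq_intros f0(2))
    show "(\<lambda>t. - 2 * \<phi>1 t / (\<phi>0 t) ^ 3) field_differentiable at t" for t
      using nz0 diff \<phi>0(3)
      by (intro field_differentiable_divide field_differentiable_mult field_differentiable_power
            field_differentiable_const) auto
    show "(\<lambda>t. 2 * f0 t * f1 t) field_differentiable at t" for t
      using diff f0(3) by (intro field_differentiable_mult field_differentiable_const)
    show "G y $ c $ d =
       (case (c, d) of
          (Inl i, Inl j) \<Rightarrow> 1 / (\<phi>0 (\<alpha> \<bullet> left_coords y))\<^sup>2 * (if i = j then \<epsilon> i else 0)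
        | (Inr a, Inr b) \<Rightarrow> (f0 (\<alpha> \<bullet> left_coords y))\<^sup>2 * K (right_coords y) $ a $ b
        | _ \<Rightarrow> 0)" if "right_coords y \<in> chart_image F j" for y c d
      by (auto simp: G_def K_def local_comp_def inv[OF that] gt_def warped_metric_def
            conformal_metric_def pseudo_euclidean_def f0(1) \<phi>0(1) split: sum.splits)
  qed (use nz0 chart \<alpha>(2) in \<open>simp_all add: K_def\<close>)
  define y :: "real^('n + 'm)" where "y = join_coords x z"
  have y: "right_coords y \<in> chart_image F j" "left_coords y = x" "right_coords y = z"
    using z by (simp_all add: y_def)
  have chart_M: "((), j) \<in> charts M" "(x, q) \<in> chart_dom M ((), j)"
    "chart_map M ((), j) (x, q) = y"
    using j q by (simp_all add: M_def product_manifold_def euclidean_manifold_def y_def z_def)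
  have "scalar_coord K z = \<kappa>"
    using F(2) j q by (simp add: constant_scalar_curvature_def scalar_curvature_def K_def z_def)
  then have S: "scalar_curvature M gt ((), j) (x, q) = \<kappa> / (f x)\<^sup>2"
    using scalar_curvature_warped[of y] y
    by (simp add: scalar_curvature_def chart_M(3) f0(1) flip: G_def)
  have "K z \<noteq> 0"
  proof
    assume "K z = 0"
    then have "K z ** matrix_inv (K z) = 0"
      by (simp add: matrix_matrix_mult_def vec_eq_iff)
    then have "mat 1 $ a $ a = (0 :: real^'m^'m) $ a $ a" for a
      using matrix_inv_mult(1)[OF K_inv[OF z]] by simp
    then show False
      by (simp add: mat_def)
  qed
  then obtain a b where ab: "K z $ a $ b \<noteq> 0"
    by (auto simp: vec_eq_iff)
  have "hessian M gt (\<lambda>(x, q). h x) ((), j) (x, q) $ Inr a $ Inr b = 0"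
    using hessian_fibre_eq_0[of "\<lambda>y. case chart_inv M ((), j) y of (x, q) \<Rightarrow> h x" h0 h1 y a b] y
    by (simp add: hessian_def Let_def chart_M(3) inv h0 flip: G_def)
  moreover have "hessian M gt (\<lambda>(x, q). h x) ((), j) (x, q)
      = (scalar_curvature M gt ((), j) (x, q) - \<rho>) *\<^sub>R gt ((), j) (x, q)"
    using soliton chart_M(1,2) unfolding gradient_yamabe_soliton_def M_def gt_def by metis
  moreover have "gt ((), j) (x, q) $ Inr a $ Inr b = (f x)\<^sup>2 * K z $ a $ b"
    by (simp add: gt_def warped_metric_def K_def local_comp_def q_z)
  ultimately have "(\<kappa> / (f x)\<^sup>2 - \<rho>) * ((f x)\<^sup>2 * K z $ a $ b) = 0"
    by (simp add: S)
  then have "\<kappa> / (f x)\<^sup>2 = \<rho>"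
    using ab nz(1)[of x] by simp
  then show ?thesis
    using nz(1)[of x] by (auto simp: field_simps)
qed

theorem corollary1p7:
  fixes \<epsilon> :: "'n::finite \<Rightarrow> real"
    and \<alpha> :: "real^'n"
    and f \<phi> h :: "real^'n \<Rightarrow> real"
    and F :: "('b, 'j, 'm::finite) manifold"
    and g_F :: "('b, 'j, 'm) tensor2"
    and lam_F :: real
  defines "M \<equiv> product_manifold euclidean_manifold F"
    and "gt \<equiv> warped_metric (conformal_metric \<phi> (pseudo_euclidean \<epsilon>)) f g_F"
    and "hM \<equiv> \<lambda>(x, q). h x"
  assumes "CARD('n) \<ge> 3"
    and "\<And>i. \<epsilon> i \<in> {-1, 1}"
    and "pseudo_riemannian F g_F"
    and "constant_scalar_curvature F g_F lam_F"
    and "smooth_on UNIV f" and "smooth_on UNIV \<phi>" and "smooth_on UNIV h"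
    and "\<And>x. f x > 0" and "\<And>x. \<phi> x \<noteq> 0"
    and "function_of_xi \<alpha> f" and "function_of_xi \<alpha> \<phi>" and "function_of_xi \<alpha> h"
    and "\<alpha> \<noteq> 0" and "(\<Sum>k\<in>UNIV. \<epsilon> k * (\<alpha> $ k)\<^sup>2) = 0"
  shows "(lam_F > 0 \<longrightarrow> \<not> expanding_soliton M gt hM \<and> \<not> steady_soliton M gt hM) \<and>
         (lam_F < 0 \<longrightarrow> \<not> shrinking_soliton M gt hM \<and> \<not> steady_soliton M gt hM)"
proof -
  have key: "lam_F = \<rho> * (f 0)\<^sup>2" if "gradient_yamabe_soliton M gt hM \<rho>" for \<rho>
    using that assms(5-10) assms(11-17) unfolding M_def gt_def hM_def
    by (intro fibre_curvature_of_lightlike_soliton[where h = h and \<epsilon> = \<epsilon> and \<alpha> = \<alpha>])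
       (auto simp: less_imp_neq[THEN not_sym])
  have "(f 0)\<^sup>2 > 0"
    using assms(11)[of 0] by simp
  then show ?thesis
    by (auto simp: expanding_soliton_def steady_soliton_def shrinking_soliton_def
        zero_less_mult_iff mult_less_0_iff dest!: key)
qed

end
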